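(* Let $n\geq 2$, $\vec k=(k_1,\ldots,k_m)$ with $1\leq k_i<n$, and $T\in \mathcal{RST}_n(\vec{k})$. Let $M_T$ be a colored noncrossing matching for $T$, and let $G_T$ and $S_T$ be the web and stranding built from $M_T$. Then the tableau of the stranding $S_T$ is $T$, i.e. $T_{S_T}=T$.
   Context: **Row-strict tableaux.** When $n\mid\sum_j k_j$, a row-strict tableau of type $\vec k$ is a filling of the $n$-row rectangular Young diagram of content $\{1^{k_1},\ldots,m^{k_m}\}$ with entries strictly increasing left to right along rows and weakly increasing top to bottom down columns; $\mathcal{RST}_n(\vec k)$ is the set of these ($\emptyset$ if $n\nmid\sum_j k_j$). **Webs and strandings.** All graphs are finite graphs embedded in the closed half-plane below a fixed horizontal line (the boundary axis), meeting it in finitely many vertices (boundary vertices; the others are interior), up to planar isotopy fixing the axis. For an oriented edge $e$ at a vertex $v$, $\sigma_v(e)=1$ if $e$ is directed into $v$ and $-1$ if out of $v$. An $\mathfrak{sl}_n$ web is such a graph with directed edges weighted in $\{1,\ldots,n-1\}$, univalent boundary vertices, trivalent interior vertices, and $\sum_{i=1}^3\sigma_v(e_i)\ell_i\equiv0\pmod n$ at each interior vertex with incident edges $e_i$ of weight $\ell_i$. A curve system is a collection of arcs (oriented simple paths in the graph with both endpoints on the axis) and loops (oriented simple closed paths); curve orientations need not agree with edge orientations. A stranding $S$ of a web is a curve system whose curves (simple strands) are colored by $\{1,\ldots,n-1\}$ with same-colored ones disjoint. For an edge $e$, $S^{+}(e)$ (resp. $S^-(e)$) is the set of colors of simple strands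 directed with (resp. against) $e$, $S(e)=S^+(e)\sqcup S^-(e)$, and $\alpha_c^\vee(S(e))=1,-1,0$ if $c\in S^+(e)$, $c\in S^-(e)$, $c\notin S(e)$. $S$ is valid if on each edge $e$ of weight $\ell$ the nonzero $\alpha_c^\vee(S(e))$ alternate in sign as $c$ increases and, with $c_{\max}=\max S(e)$, $\sum_c\alpha^\vee_c(S(e))c$ is $\ell$ if $c_{\max}\in S^+(e)$ and $\ell-n$ if $c_{\max}\in S^-(e)$. For valid $S$, $b_S(e)\in\{0,1\}^n$ is the binary vector with $b_c-b_{c+1}=\alpha_c^\vee(S(e))$ for $1\le c<n$ and last entry $0$ if $c_{\max}\in S^+(e)$, $1$ if $c_{\max}\in S^-(e)$. **Colored noncrossing matching $M_T$.** (1) Place boundary vertices $v_1,\ldots,v_m$ left to right on the axis. For each $i$ and each color $c\in\{1,\ldots,n-1\}$, if $i$ occurs in exactly one of rows $c,c+1$ of $T$, attach to $v_i$ a color-$c$ endpoint, of type "in" if $i$ lies in row $c$ and "out" if $i$ lies in row $c+1$. (2) For each $c$, take the unique noncrossing matching of the color-$c$ endpoints pairing every in-endpoint with an out-endpoint to its right; write its pairs $(v_a,v_b)$ with $v_a$ the in-endpoint, $v_b$ the out-endpoint, $a<b$. (3) For each pair $(v_a,v_b)$ of color $c$ draw an arc of color $c$ below the axis, oriented from $v_b$ to $v_a$, so that: (a) arcs of the same color are disjoint; (b) at each vertex, reading incident arcs from left to right below the axis, every out-arc precedes every in-arc, and the out-arc colors increase while the in-arc colors decrease (or the out-arc colors decrease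 and the in-arc colors increase); (c) away from their endpoints, two arcs of different colors cross at most once; (d) away from the boundary, no point lies on more than two arcs. (4) $M_T$ is the resulting oriented half-plane graph: arc-crossings are 4-valent interior vertices, boundary vertices are $v_1,\ldots,v_m$, and each arc is broken into edges inheriting its orientation. The colored arcs form a curve system $C_T$ on $M_T$. Any such $M_T$ is called a colored noncrossing matching for $T$. **Web $G_T$ and stranding $S_T$.** Built from $M_T$ as follows. (1) Crossings: at each crossing (with arcs of colors $c\neq c'$, two incoming and two outgoing half-edges) split the 4-valent vertex into two trivalent vertices joined by a new edge, each new vertex being incident to the incoming half-edge of one arc and the outgoing half-edge of the other arc, so that the new edge separates the face lying between the two incoming half-edges from the face lying between the two outgoing half-edges. Each of the two arcs runs in along its incoming edge, through the new edge, and out along its outgoing edge; they traverse the new edge in opposite directions. (2) Boundary vertices: at a boundary vertex $v_j$ with $p$ out-arcs and $q$ in-arcs, $p+q>1$, where the colors read left to right below the axis are $h_p,\ldots,h_1$ (out) followed by $r_1,\ldots,r_q$ (in), replace a neighborhood by a vertical trunk of $p+q-1$ consecutive edges descending from $v_j$, with branches: out-arc branches attached on the left and in-arc branches on the right, in the same cyclic order as in $M_T$; the lowest trunk vertex carries the two branches $h_1$ (left) and $r_1$ (right), every other interior trunk vertex carries one branch, and from bottom to top the branch colors form a monotone sequence. The in-arc $r_i$ runs along its branch to the trunk and then up the trunk to $v_j$; the out-arc $h_i$ runs from $v_j$ down the trunk to its branch. (3) All other portions of edges (including boundary vertices with a single incident edge) are unchanged, carrying their arc as a strand. (4) Orient each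 edge of the resulting graph $G_T$ in the direction of the largest-colored strand on it and weight it by the alternating sum $\sum_c\pm c$ over colors on it, with sign $+$ if the strand of color $c$ runs with the edge and $-$ if against. The colored arcs so rerouted form the curve system $S_T$ on $G_T$. ($G_T$ is an $\mathfrak{sl}_n$ web and $S_T$ a valid stranding of it.) **Tableau of a stranding.** For a valid stranding $S$ of a web with boundary vertices $v_1,\ldots,v_m$ and boundary edges $e_1,\ldots,e_m$, let $\hat b_S(e_j)=b_S(e_j)$ if $\sigma_{v_j}(e_j)=1$ and $\vec 1-b_S(e_j)$ if $\sigma_{v_j}(e_j)=-1$. $T_S$ is obtained by placing $j$ in row $c$ ($1\le c\le n$) exactly when $\hat b_S(e_j)_c=1$ (equivalently $x_c$ occurs in the $j$th tensor factor of the strand monomial $x_S=x_{\hat b_S(e_1)}\otimes\cdots\otimes x_{\hat b_S(e_m)}$) and arranging each row in increasing order. *)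

theory Defs
  imports "HOL-Analysis.Analysis"
begin

section \<open>Row-strict tableaux\<close>

text \<open>A filling of a rectangular diagram is the list of its rows, from top to bottom. Rows,
  columns of binary vectors and boundary vertices are numbered from 1, as in the mathematics.\<close>

definition RST :: "nat \<Rightarrow> nat \<Rightarrow> (nat \<Rightarrow> nat) \<Rightarrow> nat list list set" where
  "RST n m k = {T. length T = n \<and>
     (\<exists>d. n * d = (\<Sum>j=1..m. k j) \<and> (\<forall>r\<in>set T. length r = d)) \<and>
     (\<forall>j. count_list (concat T) j = (if j \<in> {1..m} then k j else 0)) \<and>
     (\<forall>r\<in>set T. sorted_wrt (<) r) \<and>
     (\<forall>i j. Suc i < n \<and> j < length (T ! i) \<longrightarrow> T ! i ! j \<le> T ! Suc i ! j)}"

definition row :: "nat list list \<Rightarrow> nat \<Rightarrow> nat set" where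
  "row T c = set (T ! (c - 1))"


section \<open>Graphs in the closed half-plane, and curves in them\<close>

definition halfplane :: "complex set" where
  "halfplane = {z. Im z \<le> 0}"

definition axis :: "complex set" where
  "axis = {z. Im z = 0}"

text \<open>A graph is a concrete set of points and arcs in the plane. Graphs are considered up to isotopy
  in the sense that nothing is assumed about the choice of the representative.

  A directed edge is a parametrised arc, directed from its start to its finish. Nothing below
  depends on the choice of the parametrisations. Loop edges are not provided for: they occur
  neither in arrangements of arcs nor in \<open>\<ss>\<ll>\<^sub>n\<close> webs (the third edge at the vertex of a loop
  edge would have weight 0 modulo n).\<close>

record halfplane_graph =
  verts :: "complex set"
  edges :: "(real \<Rightarrow> complex) set"

record weighted_graph = halfplane_graph +
  weight :: "(real \<Rightarrow> complex) \<Rightarrow> int"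

definition halfplane_graph :: "'r halfplane_graph_scheme \<Rightarrow> bool" where
  "halfplane_graph G \<longleftrightarrow>
     finite (verts G) \<and> finite (edges G) \<and> verts G \<subseteq> halfplane \<and>
     (\<forall>e\<in>edges G. arc e \<and> path_image e \<subseteq> halfplane \<and>
        path_image e \<inter> (verts G \<union> axis) = {pathstart e, pathfinish e} \<and>
        pathstart e \<in> verts G \<and> pathfinish e \<in> verts G) \<and>
     (\<forall>e\<in>edges G. \<forall>e'\<in>edges G. e \<noteq> e' \<longrightarrow> path_image e \<inter> path_image e' \<subseteq> verts G)"

definition boundary_verts :: "'r halfplane_graph_scheme \<Rightarrow> complex set" where
  "boundary_verts G = verts G \<inter> axis"

definition interior_verts :: "'r halfplane_graph_scheme \<Rightarrow> complex set" where
  "interior_verts G = verts G - axis"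

text \<open>The boundary vertices from left to right are \<open>bvert G 1, \<dots>, bvert G m\<close>.\<close>

definition bvert :: "'r halfplane_graph_scheme \<Rightarrow> nat \<Rightarrow> complex" where
  "bvert G j = complex_of_real (sorted_list_of_set (Re ` boundary_verts G) ! (j - 1))"

text \<open>\<open>traverses p e\<close>: the parametrised curve \<open>p\<close> contains the arc \<open>e\<close> and runs through it in the
  direction of \<open>e\<close>. A closed curve may have its base point inside \<open>e\<close>, whence the shift in
  \<open>directed_with\<close>.\<close>

definition traverses :: "(real \<Rightarrow> complex) \<Rightarrow> (real \<Rightarrow> complex) \<Rightarrow> bool" where
  "traverses p e \<longleftrightarrow> (\<exists>s t. 0 \<le> s \<and> s < t \<and> t \<le> 1 \<and>
     p s = pathstart e \<and> p t = pathfinish e \<and> p ` {s..t} = path_image e)"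

definition directed_with :: "(real \<Rightarrow> complex) \<Rightarrow> (real \<Rightarrow> complex) \<Rightarrow> bool" where
  "directed_with p e \<longleftrightarrow> traverses p e \<or>
     (pathfinish p = pathstart p \<and> (\<exists>a\<in>{0..1}. traverses (shiftpath a p) e))"

definition curve_system :: "'r halfplane_graph_scheme \<Rightarrow> (real \<Rightarrow> complex) set \<Rightarrow> bool" where
  "curve_system G \<Gamma> \<longleftrightarrow> (\<forall>p\<in>\<Gamma>.
     (arc p \<and> pathstart p \<in> axis \<and> pathfinish p \<in> axis \<or>
      simple_path p \<and> pathfinish p = pathstart p) \<and>
     (\<exists>F\<subseteq>edges G. path_image p = (\<Union>e\<in>F. path_image e)))"

text \<open>A colored curve is a pair of its color and a parametrisation.\<close>

type_synonym colored_curve = "nat \<times> (real \<Rightarrow> complex)"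


section \<open>The tableau of a stranding\<close>

text \<open>The following functions are meant for valid strandings of \<open>\<ss>\<ll>\<^sub>n\<close> webs. Validity guarantees
  that \<open>edge_vector\<close> exists; a univalent boundary vertex makes \<open>edge_at\<close> well defined. Without these
  properties the values are unspecified.\<close>

definition colors_with :: "colored_curve set \<Rightarrow> (real \<Rightarrow> complex) \<Rightarrow> nat set" where
  "colors_with S e = {c. \<exists>p. (c, p) \<in> S \<and> directed_with p e}"

definition colors_against :: "colored_curve set \<Rightarrow> (real \<Rightarrow> complex) \<Rightarrow> nat set" where
  "colors_against S e = {c. \<exists>p. (c, p) \<in> S \<and> directed_with p (reversepath e)}"

definition colors_on :: "colored_curve set \<Rightarrow> (real \<Rightarrow> complex) \<Rightarrow> nat set" where
  "colors_on S e = colors_with S e \<union> colors_against S e"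

definition color_sign :: "colored_curve set \<Rightarrow> (real \<Rightarrow> complex) \<Rightarrow> nat \<Rightarrow> int" where
  "color_sign S e c =
     (if c \<in> colors_with S e then 1 else if c \<in> colors_against S e then -1 else 0)"

definition edge_vector ::
    "nat \<Rightarrow> colored_curve set \<Rightarrow> (real \<Rightarrow> complex) \<Rightarrow> nat \<Rightarrow> int" where
  "edge_vector n S e = (THE b.
     (\<forall>c\<in>{1..n}. b c \<in> {0, 1}) \<and> (\<forall>c. c \<notin> {1..n} \<longrightarrow> b c = 0) \<and>
     (\<forall>c\<in>{1..<n}. b c - b (c + 1) = color_sign S e c) \<and>
     b n = (if Max (colors_on S e) \<in> colors_with S e then 0 else 1))"

definition edge_at :: "'r halfplane_graph_scheme \<Rightarrow> complex \<Rightarrow> (real \<Rightarrow> complex)" where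
  "edge_at G v = (THE e. e \<in> edges G \<and> v \<in> {pathstart e, pathfinish e})"

definition incidence_sign :: "complex \<Rightarrow> (real \<Rightarrow> complex) \<Rightarrow> int" where
  "incidence_sign v e = (if pathfinish e = v then 1 else -1)"

definition boundary_vector ::
    "nat \<Rightarrow> 'r halfplane_graph_scheme \<Rightarrow> colored_curve set \<Rightarrow> nat \<Rightarrow> nat \<Rightarrow> int" where
  "boundary_vector n G S j c =
     (let v = bvert G j; e = edge_at G v in
      if incidence_sign v e = 1 then edge_vector n S e c else 1 - edge_vector n S e c)"

definition stranding_tableau ::
    "nat \<Rightarrow> 'r halfplane_graph_scheme \<Rightarrow> colored_curve set \<Rightarrow> nat list list" where
  "stranding_tableau n G S =
     map (\<lambda>c. sorted_list_of_set
            {j\<in>{1..card (boundary_verts G)}. boundary_vector n G S j c = 1})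
       [1..<Suc n]"


section \<open>Colored noncrossing matchings\<close>

definition in_endpoints :: "nat \<Rightarrow> nat list list \<Rightarrow> nat \<Rightarrow> nat set" where
  "in_endpoints m T c = {i\<in>{1..m}. i \<in> row T c \<and> i \<notin> row T (c + 1)}"

definition out_endpoints :: "nat \<Rightarrow> nat list list \<Rightarrow> nat \<Rightarrow> nat set" where
  "out_endpoints m T c = {i\<in>{1..m}. i \<notin> row T c \<and> i \<in> row T (c + 1)}"

definition noncrossing_matching :: "nat set \<Rightarrow> nat set \<Rightarrow> (nat \<times> nat) set \<Rightarrow> bool" where
  "noncrossing_matching I J P \<longleftrightarrow>
     P \<subseteq> I \<times> J \<and> (\<forall>a\<in>I. \<exists>!b. (a, b) \<in> P) \<and> (\<forall>b\<in>J. \<exists>!a. (a, b) \<in> P) \<and>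
     (\<forall>(a, b)\<in>P. a < b) \<and>
     \<not> (\<exists>a b a' b'. (a, b) \<in> P \<and> (a', b') \<in> P \<and> a < a' \<and> a' < b \<and> b < b')"

definition out_arcs :: "colored_curve set \<Rightarrow> complex \<Rightarrow> colored_curve set" where
  "out_arcs C v = {a\<in>C. pathstart (snd a) = v}"

definition in_arcs :: "colored_curve set \<Rightarrow> complex \<Rightarrow> colored_curve set" where
  "in_arcs C v = {a\<in>C. pathfinish (snd a) = v}"

definition arcs_at :: "colored_curve set \<Rightarrow> complex \<Rightarrow> colored_curve set" where
  "arcs_at C v = out_arcs C v \<union> in_arcs C v"

text \<open>The local pictures at vertices are described in charts, i.e. parametrisations of a small
  neighbourhood by a standard square, which meets the arc system \<open>C\<close> only as prescribed. A
  continuous injection of a compact set is a homeomorphism onto its image.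

  A crossing, in the chart: \<open>a\<close> and \<open>a'\<close> are the two diagonals, both directed upwards, \<open>a\<close> coming
  from the lower left corner and \<open>a'\<close> from the lower right one. The chart may reverse the
  orientation of the plane, so that the two arcs can play either role.\<close>

definition full_square :: "complex set" where
  "full_square = cbox (Complex (-1) (-1)) (Complex 1 1)"

definition crossing_chart ::
    "colored_curve set \<Rightarrow> colored_curve \<Rightarrow> colored_curve \<Rightarrow> complex \<Rightarrow> (complex \<Rightarrow> complex) \<Rightarrow> bool"
where
  "crossing_chart C a a' z \<psi> \<longleftrightarrow>
     continuous_on full_square \<psi> \<and> inj_on \<psi> full_square \<and> \<psi> 0 = z \<and>
     z \<in> interior (\<psi> ` full_square) \<and> \<psi> ` full_square \<subseteq> halfplane - axis \<and>
     a \<in> C \<and> a' \<in> C \<and> a \<noteq> a' \<and>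
     path_image (snd a) \<inter> \<psi> ` full_square =
       \<psi> ` closed_segment (Complex (-1) (-1)) (Complex 1 1) \<and>
     traverses (snd a) (\<psi> \<circ> linepath (Complex (-1) (-1)) (Complex 1 1)) \<and>
     path_image (snd a') \<inter> \<psi> ` full_square =
       \<psi> ` closed_segment (Complex 1 (-1)) (Complex (-1) 1) \<and>
     traverses (snd a') (\<psi> \<circ> linepath (Complex 1 (-1)) (Complex (-1) 1)) \<and>
     (\<forall>q\<in>C - {a, a'}. path_image (snd q) \<inter> \<psi> ` full_square = {})"

text \<open>At a boundary vertex the chart respects the axis and its left-to-right direction; the incident
  arcs are the segments from \<open>0\<close> to the points \<open>t a\<close> of the bottom side. Hence the left-to-right
  order of the arcs at the vertex is the order of the numbers \<open>t a\<close>.\<close>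

definition half_square :: "complex set" where
  "half_square = cbox (Complex (-1) (-1)) (Complex 1 0)"

definition boundary_chart ::
    "colored_curve set \<Rightarrow> complex \<Rightarrow> (complex \<Rightarrow> complex) \<Rightarrow> (colored_curve \<Rightarrow> real) \<Rightarrow> bool" where
  "boundary_chart C v \<psi> t \<longleftrightarrow>
     continuous_on half_square \<psi> \<and> inj_on \<psi> half_square \<and> \<psi> 0 = v \<and>
     (\<exists>\<epsilon>>0. ball v \<epsilon> \<inter> halfplane \<subseteq> \<psi> ` half_square) \<and> \<psi> ` half_square \<subseteq> halfplane \<and>
     (\<forall>w\<in>half_square. \<psi> w \<in> axis \<longleftrightarrow> w \<in> axis) \<and>
     strict_mono_on {-1..1} (\<lambda>x. Re (\<psi> (complex_of_real x))) \<and>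
     (\<forall>a\<in>arcs_at C v. -1 < t a \<and> t a < 1 \<and>
        path_image (snd a) \<inter> \<psi> ` half_square = \<psi> ` closed_segment 0 (Complex (t a) (-1))) \<and>
     (\<forall>a\<in>C - arcs_at C v. path_image (snd a) \<inter> \<psi> ` half_square = {})"

text \<open>\<open>M\<close> is a colored noncrossing matching for \<open>T\<close> with curve system \<open>C\<close>. As arcs of one color are
  disjoint, there is exactly one arc of color \<open>c\<close> for each pair of the matching in color \<open>c\<close>.
  Crossing charts exist at every common interior point of two arcs because such points are
  crossings, not points of tangency.\<close>

definition colored_noncrossing_matching ::
    "nat \<Rightarrow> nat \<Rightarrow> nat list list \<Rightarrow> halfplane_graph \<Rightarrow> colored_curve set \<Rightarrow> bool" where
  "colored_noncrossing_matching n m T M C \<longleftrightarrow>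
     halfplane_graph M \<and> card (boundary_verts M) = m \<and>
     interior_verts M =
       {z. z \<notin> axis \<and> (\<exists>a\<in>C. \<exists>a'\<in>C. a \<noteq> a' \<and> z \<in> path_image (snd a) \<inter> path_image (snd a'))} \<and>
     curve_system M (snd ` C) \<and>
     (\<forall>e\<in>edges M. \<exists>a\<in>C. directed_with (snd a) e) \<and>
     (\<forall>(c, p)\<in>C. c \<in> {1..<n} \<and> arc p \<and> path_image p \<inter> axis = {pathstart p, pathfinish p} \<and>
        (\<exists>a\<in>{1..m}. \<exists>b\<in>{1..m}. pathstart p = bvert M b \<and> pathfinish p = bvert M a)) \<and>
     (\<forall>c\<in>{1..<n}. noncrossing_matching (in_endpoints m T c) (out_endpoints m T c)
        {(a, b). a \<in> {1..m} \<and> b \<in> {1..m} \<and>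
           (\<exists>p. (c, p) \<in> C \<and> pathstart p = bvert M b \<and> pathfinish p = bvert M a)}) \<and>
     (\<forall>a\<in>C. \<forall>a'\<in>C. a \<noteq> a' \<and> fst a = fst a' \<longrightarrow>
        path_image (snd a) \<inter> path_image (snd a') = {}) \<and>
     (\<forall>v\<in>boundary_verts M. \<exists>\<psi> t. boundary_chart C v \<psi> t \<and>
        (\<forall>a\<in>out_arcs C v. \<forall>a'\<in>in_arcs C v. t a < t a') \<and>
        ((\<forall>a\<in>out_arcs C v. \<forall>a'\<in>out_arcs C v. t a < t a' \<longrightarrow> fst a < fst a') \<and>
         (\<forall>a\<in>in_arcs C v. \<forall>a'\<in>in_arcs C v. t a < t a' \<longrightarrow> fst a > fst a') \<or>
         (\<forall>a\<in>out_arcs C v. \<forall>a'\<in>out_arcs C v. t a < t a' \<longrightarrow> fst a > fst a') \<and>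
         (\<forall>a\<in>in_arcs C v. \<forall>a'\<in>in_arcs C v. t a < t a' \<longrightarrow> fst a < fst a'))) \<and>
     (\<forall>a\<in>C. \<forall>a'\<in>C. fst a \<noteq> fst a' \<longrightarrow>
        (\<forall>z\<in>path_image (snd a) \<inter> path_image (snd a') - axis.
           (\<exists>\<psi>. crossing_chart C a a' z \<psi>) \<and>
           (\<forall>z'\<in>path_image (snd a) \<inter> path_image (snd a') - axis. z = z'))) \<and>
     (\<forall>z. z \<notin> axis \<longrightarrow> card {a\<in>C. z \<in> path_image (snd a)} \<le> 2)"


section \<open>The web and the stranding built from a colored noncrossing matching\<close>

text \<open>In both local replacements, \<open>U\<close> is the neighbourhood that is replaced, \<open>W\<close> the set of new
  trivalent vertices in it, and \<open>\<rho> a\<close> the part in \<open>U\<close> of the rerouted arc \<open>a\<close>.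

  At a crossing the new edge is horizontal in the chart: it separates the face at the bottom,
  between the incoming half-edges, from the face at the top.\<close>

definition crossing_replacement ::
    "colored_curve set \<Rightarrow> complex \<Rightarrow> complex set \<Rightarrow> complex set \<Rightarrow>
     (colored_curve \<Rightarrow> complex set) \<Rightarrow> bool" where
  "crossing_replacement C z U W \<rho> \<longleftrightarrow> (\<exists>\<psi> a a'. crossing_chart C a a' z \<psi> \<and>
     U = \<psi> ` full_square \<and> W = \<psi> ` {-1/2, 1/2} \<and>
     \<rho> a = \<psi> ` (closed_segment (Complex (-1) (-1)) (-1/2) \<union> closed_segment (-1/2) (1/2) \<union>
                closed_segment (1/2) (Complex 1 1)) \<and>
     \<rho> a' = \<psi> ` (closed_segment (Complex 1 (-1)) (1/2) \<union> closed_segment (1/2) (-1/2) \<union>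
                 closed_segment (-1/2) (Complex (-1) 1)) \<and>
     (\<forall>q. q \<notin> {a, a'} \<longrightarrow> \<rho> q = {}))"

text \<open>At a boundary vertex with \<open>d > 1\<close> arcs the trunk is vertical in the chart. Its vertices are
  numbered downwards, from level 0 (the boundary vertex) to level \<open>d - 1\<close>, and \<open>\<kappa> a\<close> is the level
  of the vertex that carries the branch of \<open>a\<close>. There are \<open>d\<close> branches, so every level except
  the lowest carries exactly one. The cyclic order is preserved if and only if branches
  attached on one side of the trunk are the lower, the closer they are to the trunk.\<close>

definition trunk_replacement ::
    "colored_curve set \<Rightarrow> complex \<Rightarrow> complex set \<Rightarrow> complex set \<Rightarrow>
     (colored_curve \<Rightarrow> complex set) \<Rightarrow> bool" where
  "trunk_replacement C v U W \<rho> \<longleftrightarrow> (\<exists>\<psi> t \<kappa>.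
     let d = card (arcs_at C v); level = (\<lambda>i::nat. Complex 0 (- real i / real d)) in
     boundary_chart C v \<psi> t \<and>
     (\<forall>a\<in>out_arcs C v. t a < 0) \<and> (\<forall>a\<in>in_arcs C v. t a > 0) \<and>
     \<kappa> ` arcs_at C v = {1..d - 1} \<and>
     (\<exists>h\<in>out_arcs C v. \<exists>r\<in>in_arcs C v. {a\<in>arcs_at C v. \<kappa> a = d - 1} = {h, r}) \<and>
     (\<forall>a\<in>out_arcs C v. \<forall>a'\<in>out_arcs C v. t a < t a' \<longrightarrow> \<kappa> a < \<kappa> a') \<and>
     (\<forall>a\<in>in_arcs C v. \<forall>a'\<in>in_arcs C v. t a < t a' \<longrightarrow> \<kappa> a > \<kappa> a') \<and>
     ((\<forall>a\<in>arcs_at C v. \<forall>a'\<in>arcs_at C v. \<kappa> a < \<kappa> a' \<longrightarrow> fst a < fst a') \<or>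
      (\<forall>a\<in>arcs_at C v. \<forall>a'\<in>arcs_at C v. \<kappa> a < \<kappa> a' \<longrightarrow> fst a > fst a')) \<and>
     U = \<psi> ` half_square \<and> W = \<psi> ` level ` {1..d - 1} \<and>
     (\<forall>a\<in>arcs_at C v. \<rho> a = \<psi> ` (closed_segment 0 (level (\<kappa> a)) \<union>
                                   closed_segment (level (\<kappa> a)) (Complex (t a) (-1)))) \<and>
     (\<forall>a. a \<notin> arcs_at C v \<longrightarrow> \<rho> a = {}))"

text \<open>\<open>G\<close> and \<open>S\<close> are the web and the stranding obtained by performing the replacements in
  disjoint neighbourhoods. \<open>f a\<close> is the rerouted arc \<open>a\<close>; an arc is determined, up to
  reparametrisation, by its image and its start and finish. The edges of \<open>G\<close> are the pieces into
  which \<open>verts G\<close> cuts the rerouted arcs, since every edge carries a strand and every strand is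
  a union of edges.\<close>

definition web_and_stranding_of ::
    "halfplane_graph \<Rightarrow> colored_curve set \<Rightarrow> weighted_graph \<Rightarrow> colored_curve set \<Rightarrow> bool" where
  "web_and_stranding_of M C G S \<longleftrightarrow> (\<exists>U W \<rho> f.
     let B = {v\<in>boundary_verts M. card (arcs_at C v) > 1}; R = interior_verts M \<union> B in
     (\<forall>z\<in>interior_verts M. crossing_replacement C z (U z) (W z) (\<rho> z)) \<and>
     (\<forall>v\<in>B. trunk_replacement C v (U v) (W v) (\<rho> v)) \<and>
     disjoint_family_on U R \<and>
     (\<forall>a\<in>C. arc (f a) \<and> pathstart (f a) = pathstart (snd a) \<and>
        pathfinish (f a) = pathfinish (snd a) \<and>
        path_image (f a) = (path_image (snd a) - (\<Union>z\<in>R. U z)) \<union> (\<Union>z\<in>R. \<rho> z a)) \<and>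
     S = (\<lambda>a. (fst a, f a)) ` C \<and>
     halfplane_graph G \<and>
     verts G = boundary_verts M \<union> (\<Union>z\<in>R. W z) \<and>
     curve_system G (snd ` S) \<and>
     (\<forall>e\<in>edges G. colors_on S e \<noteq> {} \<and> Max (colors_on S e) \<in> colors_with S e \<and>
        weight G e = (\<Sum>c\<in>colors_on S e. color_sign S e c * int c)))"

end

theory Submission
  imports Defs
begin

text \<open>Only the boundary edges matter. Close to a boundary vertex all rerouted arcs that end there run
  along the trunk (or there is a single one), so there is exactly one boundary edge, and the strands
  on it are these arcs, the in-arcs directed towards the axis and the out-arcs away from it. By the
  definition of the endpoints, the sign of color \<open>c\<close> on the edge of \<open>v\<^sub>j\<close>, directed towards the axis, is
  \<open>[j \<in> row c] - [j \<in> row (c + 1)]\<close>. So the binary vector of the edge and the indicator of the rows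
  containing \<open>j\<close> have the same differences. Their last entries agree as well: above the largest color
  on the edge the indicator is constant, and the direction of that color decides its value.\<close>

section \<open>Traversal of arcs\<close>

lemma traverses_path_image: "traverses p e \<Longrightarrow> path_image e \<subseteq> path_image p"
  by (fastforce simp: traverses_def path_image_def)

text \<open>The parameter interval \<open>{s..t}\<close> becomes \<open>{1 - t..1 - s}\<close>.
  Reversal turns statements about starts into statements about finishes below.\<close>

lemma traverses_reversepath:
  "traverses (reversepath p) (reversepath e) \<longleftrightarrow> traverses p e"
proof -
  have *: "traverses (reversepath p) (reversepath e)" if pe: "traverses p e" for p e
  proof -
    obtain s t where st: "0 \<le> s" "s < t" "t \<le> 1" "p s = pathstart e" "p t = pathfinish e"
      "p ` {s..t} = path_image e"
      using pe by (auto simp: traverses_def)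
    have "reversepath p ` {1 - t..1 - s} = p ` (\<lambda>x. 1 - x) ` {1 - t..1 - s}"
      by (simp only: reversepath_def image_image)
    also have "(\<lambda>x. 1 - x) ` {1 - t..1 - s} = {s..t}"
      by simp
    finally have "reversepath p ` {1 - t..1 - s} = path_image (reversepath e)"
      using st by simp
    moreover have "reversepath p (1 - t) = pathfinish e" "reversepath p (1 - s) = pathstart e"
      using st by (simp_all add: reversepath_def)
    ultimately show ?thesis
      unfolding traverses_def using st by (intro exI[of _ "1 - t"] exI[of _ "1 - s"]) simp
  qed
  show ?thesis
    \<comment> \<open>Reversal is an involution, so the converse is the same implication for the
      reversed paths.\<close>
    using *[of p e] *[of "reversepath p" "reversepath e"] by auto
qed

text \<open>The traversal begins at a parameter \<open>s < t \<le> 1\<close>, and injectivity of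
  \<open>p\<close> keeps \<open>p s\<close> away from the finish of \<open>p\<close>.\<close>

lemma traverses_pathstart_eq:
  assumes "arc p" "traverses p e" "pathstart e \<in> {pathstart p, pathfinish p}"
  shows "pathstart e = pathstart p"
proof -
  obtain s t where st: "0 \<le> s" "s < t" "t \<le> 1" "p s = pathstart e"
    using assms(2) by (auto simp: traverses_def)
  have "p s \<noteq> p 1"
    using inj_onD[OF conjunct2[OF assms(1)[unfolded arc_def]], of s 1] st by auto
  then show ?thesis
    using assms(3) st by (auto simp: pathfinish_def)
qed

lemma traverses_pathfinish_eq:
  assumes "arc p" "traverses p e" "pathfinish e \<in> {pathstart p, pathfinish p}"
  shows "pathfinish e = pathfinish p"
  using traverses_pathstart_eq[of "reversepath p" "reversepath e"] assms
  by (auto simp: traverses_reversepath arc_reversepath)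

text \<open>The shifted alternative in \<open>directed_with\<close> concerns closed curves, and the
  ends of an arc are distinct.\<close>

lemma arc_directed_with:
  assumes "arc p"
  shows "directed_with p e \<longleftrightarrow> traverses p e"
  using arc_distinct_ends[OF assms] by (auto simp: directed_with_def)

text \<open>Pulled back along the inverse homeomorphism \<open>h\<close> of \<open>p\<close>, the
  arc \<open>e\<close> becomes an injective path in the unit interval that starts at 0. It therefore
  covers exactly an initial interval, on which \<open>p\<close> runs through \<open>e\<close> in the
  direction of \<open>e\<close>.\<close>

lemma arc_traverses_subarc:
  assumes p: "arc p" and e: "arc e" and sub: "path_image e \<subseteq> path_image p"
    and start: "pathstart e = pathstart p"
  shows "traverses p e"
proof -
  obtain h where h: "homeomorphism {0..1} (path_image p) p h"
    using homeomorphism_arc[OF p] .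
  let ?u = "h (pathfinish e)"
  have fin: "pathfinish e \<in> path_image p"
    using sub by blast
  have "continuous_on {0..1} (h \<circ> e)"
    using e sub homeomorphism_cont2[OF h]
    by (intro continuous_on_compose) (auto simp: arc_def path_def path_image_def intro: continuous_on_subset)
  moreover have "inj_on (h \<circ> e) {0..1}"
  proof -
    have "inj_on h (path_image p)"
      using homeomorphism_apply2[OF h] by (intro inj_on_inverseI[of _ p]) auto
    then show ?thesis
      using e sub by (intro comp_inj_on) (auto simp: arc_def path_image_def intro: inj_on_subset)
  qed
  \<comment> \<open>A continuous injective real function maps an interval onto the segment between
    its end values.\<close>
  ultimately have "(h \<circ> e) ` {0..1} = closed_segment ((h \<circ> e) 0) ((h \<circ> e) 1)"
    using continuous_injective_image_segment_1[of 0 1 "h \<circ> e"] by (simp add: closed_segment_eq_real_ivl)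
  moreover have h0: "h (e 0) = 0"
    using start homeomorphism_apply1[OF h, of 0] by (simp add: pathstart_def)
  moreover have u: "0 \<le> ?u" "?u \<le> 1"
    using fin homeomorphism_image2[OF h] by force+
  ultimately have img: "h ` path_image e = {0..?u}"
    by (simp add: closed_segment_eq_real_ivl image_comp path_image_def pathfinish_def)
  have ph: "p (h x) = x" if "x \<in> path_image e" for x
    using that sub homeomorphism_apply2[OF h] by blast
  have "p ` {0..?u} = path_image e"
    unfolding img[symmetric] using ph by (force simp: image_image)
  moreover have "?u \<noteq> 0"
    using ph[of "pathfinish e"] start arc_distinct_ends[OF e]
    by (metis pathfinish_in_path_image pathstart_def)
  ultimately show ?thesis
    unfolding traverses_def using u ph[of "pathfinish e"] start
    by (intro exI[of _ 0] exI[of _ ?u]) (auto simp: pathstart_def)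
qed

lemma arc_traverses_subarc_finish:
  assumes "arc p" "arc e" "path_image e \<subseteq> path_image p" "pathfinish e = pathfinish p"
  shows "traverses p e"
  using arc_traverses_subarc[of "reversepath p" "reversepath e"] assms
  by (simp add: traverses_reversepath arc_reversepath)

text \<open>The parameters of the points of \<open>K\<close> form a connected set of reals that
  contains 0 and the positive parameter of \<open>x\<close>, hence all of the interval between
  them.\<close>

lemma connected_in_arc_initial:
  fixes p :: "real \<Rightarrow> 'a::t2_space"
  assumes p: "arc p" and K: "connected K" "K \<subseteq> path_image p" "pathstart p \<in> K"
    and x: "x \<in> K" "x \<noteq> pathstart p"
  shows "\<exists>\<delta>. 0 < \<delta> \<and> \<delta> \<le> 1 \<and> p ` {0..\<delta>} \<subseteq> K"
proof -
  obtain h where h: "homeomorphism {0..1} (path_image p) p h"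
    using homeomorphism_arc[OF p] .
  have ph: "p (h y) = y" if "y \<in> K" for y
    using that K homeomorphism_apply2[OF h] by blast
  have "connected (h ` K)"
    using K homeomorphism_cont2[OF h] by (meson connected_continuous_image continuous_on_subset)
  moreover have "0 \<in> h ` K"
    using K homeomorphism_apply1[OF h, of 0] by (force simp: pathstart_def)
  ultimately have "{0..h x} \<subseteq> h ` K"
    using x by (simp add: connected_contains_Icc)
  then have "p ` {0..h x} \<subseteq> K"
    using ph by force
  moreover have "h x \<in> {0..1}"
    using x K homeomorphism_image2[OF h] by blast
  moreover have "h x \<noteq> 0"
    using ph[OF x(1)] x(2) by (metis pathstart_def)
  ultimately show ?thesis
    by (intro exI[of _ "h x"]) auto
qed

text \<open>Distinct edges share only finitely many points, so a common initial piece forces two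
  edges to coincide.\<close>

lemma arc_initial_infinite:
  assumes "arc p" "0 < \<delta>" "\<delta> \<le> 1"
  shows "infinite (p ` {0..\<delta>})"
proof -
  have "inj_on p {0..\<delta>}"
    using assms by (auto simp: arc_def inj_on_def)
  then show ?thesis
    using assms by (simp add: finite_image_iff infinite_Icc)
qed

section \<open>Row-strict tableaux\<close>

text \<open>A strictly increasing list is recovered from its set of entries, so passing to
  \<open>row\<close> loses nothing.\<close>

lemma RST_row_nth:
  assumes "T \<in> RST n m k" "c \<in> {1..n}"
  shows "T ! (c - 1) = sorted_list_of_set (row T c)"
proof -
  have "T ! (c - 1) \<in> set T"
    using assms by (auto simp: RST_def)
  then have "sorted_wrt (<) (T ! (c - 1))"
    using assms by (auto simp: RST_def)
  then show ?thesis
    unfolding row_def by (metis sorted_list_of_set.idem_if_sorted_distinct strict_sorted_iff)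
qed

lemma RST_row_subset:
  assumes "T \<in> RST n m k" "c \<in> {1..n}"
  shows "row T c \<subseteq> {1..m}"
proof
  fix j assume "j \<in> row T c"
  moreover have "T ! (c - 1) \<in> set T"
    using assms by (auto simp: RST_def)
  ultimately have "count_list (concat T) j \<noteq> 0"
    by (auto simp: row_def count_list_0_iff)
  then show "j \<in> {1..m}"
    using assms(1) by (auto simp: RST_def split: if_splits)
qed

text \<open>Strict increase lets \<open>j\<close> occur at most once in a row, so its multiplicity
  in the filling counts the rows that contain it.\<close>

lemma RST_card_rows:
  assumes T: "T \<in> RST n m k" and j: "j \<in> {1..m}"
  shows "card {c\<in>{1..n}. j \<in> row T c} = k j"
proof -
  have len: "length T = n"
    using T by (auto simp: RST_def)
  have count: "count_list r j = (if j \<in> set r then 1 else 0)" if "r \<in> set T" for r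
  proof -
    have "distinct r"
      using T that by (auto simp: RST_def strict_sorted_iff)
    then show ?thesis
      by (induction r) auto
  qed
  have "k j = (\<Sum>r\<leftarrow>T. count_list r j)"
    using T j by (auto simp: RST_def count_list_concat)
  also have "\<dots> = (\<Sum>i<n. count_list (T ! i) j)"
    by (simp add: sum_list_sum_nth len atLeast0LessThan)
  also have "\<dots> = (\<Sum>i<n. if j \<in> row T (Suc i) then 1 else 0)"
    using len by (intro sum.cong) (auto simp: row_def count)
  also have "\<dots> = (\<Sum>c\<in>{1..n}. if j \<in> row T c then 1 else 0)"
    by (rule sum.reindex_bij_witness[of _ "\<lambda>c. c - 1" Suc]) auto
  also have "\<dots> = card {c\<in>{1..n}. j \<in> row T c}"
    by (simp add: sum.If_cases Int_def)
  finally show ?thesis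
    by simp
qed

text \<open>Without a change \<open>j\<close> would lie in all rows or in none, giving
  \<open>k j\<close> the value \<open>n\<close> or 0. A change means that at least one arc ends at
  the boundary vertex \<open>j\<close>.\<close>

lemma RST_exists_change:
  assumes T: "T \<in> RST n m k" and j: "j \<in> {1..m}" and k: "1 \<le> k j" "k j < n"
  shows "\<exists>c\<in>{1..<n}. (j \<in> row T c) \<noteq> (j \<in> row T (c + 1))"
proof (rule ccontr)
  assume "\<not> ?thesis"
  then have step: "j \<in> row T c \<longleftrightarrow> j \<in> row T (Suc c)" if "c \<in> {1..<n}" for c
    using that by auto
  have "j \<in> row T c \<longleftrightarrow> j \<in> row T 1" if "1 \<le> c" "c \<le> n" for c
    using that by (induction c rule: dec_induct) (auto simp: step)
  then have "{c\<in>{1..n}. j \<in> row T c} = (if j \<in> row T 1 then {1..n} else {})"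
    by auto
  then show False
    using RST_card_rows[OF T j] k by (auto split: if_splits)
qed

section \<open>Boundary vectors\<close>

text \<open>The prescribed differences and the last entry determine the vector, and the indicator of
  \<open>R\<close> satisfies both. \<open>R\<close> will be the set of rows containing
  \<open>j\<close>, or its complement, depending on the direction of the edge.\<close>

lemma edge_vector_eq_indicator:
  assumes with_eq: "colors_with S e = {c\<in>{1..<n}. c \<in> R \<and> c + 1 \<notin> R}"
    and against_eq: "colors_against S e = {c\<in>{1..<n}. c \<notin> R \<and> c + 1 \<in> R}"
    and ne: "colors_on S e \<noteq> {}" and max: "Max (colors_on S e) \<in> colors_with S e"
    and c: "c \<in> {1..n}"
  shows "edge_vector n S e c = (if c \<in> R then 1 else 0)"
proof -
  let ?P = "\<lambda>b. (\<forall>c\<in>{1..n}. b c \<in> {0, 1}) \<and> (\<forall>c. c \<notin> {1..n} \<longrightarrow> b c = 0) \<and>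
     (\<forall>c\<in>{1..<n}. b c - b (c + 1) = color_sign S e c) \<and>
     b n = (if Max (colors_on S e) \<in> colors_with S e then 0 else (1::int))"
  \<comment> \<open>The cut-off to \<open>{1..n}\<close> matches the default value 0 that makes the
    vector in \<open>edge_vector\<close> unique as a function.\<close>
  let ?b = "\<lambda>c. if c \<in> {1..n} \<and> c \<in> R then 1 else 0 :: int"
  let ?M = "Max (colors_on S e)"
  have fin: "finite (colors_on S e)"
    unfolding colors_on_def with_eq against_eq by auto
  \<comment> \<open>No color above the largest one occurs on \<open>e\<close>, so membership in
    \<open>R\<close> is constant from \<open>?M + 1\<close> to \<open>n\<close>; since
    \<open>?M\<close> runs with \<open>e\<close>, it fails at \<open>?M + 1\<close>.\<close>
  have "n \<notin> R"
  proof -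
    have step: "c \<in> R \<longleftrightarrow> Suc c \<in> R" if "?M < c" "c < n" for c
    proof -
      have "c \<notin> colors_on S e"
        using Max_ge[OF fin, of c] that by auto
      then show ?thesis
        using that by (auto simp: colors_on_def with_eq against_eq)
    qed
    have M: "?M < n" "Suc ?M \<notin> R"
      using max by (auto simp: with_eq)
    have "c \<notin> R" if "Suc ?M \<le> c" "c \<le> n" for c
      using that by (induction c rule: dec_induct) (use M step in auto)
    then show ?thesis
      using M by auto
  qed
  then have b: "?P ?b"
    using max by (auto simp: color_sign_def with_eq against_eq)
  have "b = ?b" if "?P b" for b
  proof
    fix c
    \<comment> \<open>Downward induction: the last entry is known, and each difference gives the
      entry before it.\<close>
    have "b c = ?b c" if "1 \<le> c" "c \<le> n"
      using that(2,1)
    proof (induction c rule: inc_induct)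
      case base
      then show ?case
        using \<open>?P b\<close> b by presburger
    next
      case (step c)
      then have c: "c \<in> {1..<n}"
        by auto
      have "b c - b (c + 1) = color_sign S e c" "?b c - ?b (c + 1) = color_sign S e c"
        using c \<open>?P b\<close> b by blast+
      moreover have "b (c + 1) = ?b (c + 1)"
        using step by simp
      ultimately show ?case
        by linarith
    qed
    moreover have "b c = ?b c" if "c \<notin> {1..n}"
      using \<open>?P b\<close> that by auto
    ultimately show "b c = ?b c"
      by fastforce
  qed
  then have "edge_vector n S e = ?b"
    unfolding edge_vector_def using b by (intro the_equality) blast+
  then show ?thesis
    using c by simp
qed

text \<open>\<open>bvert G\<close> is the composition of an index shift, the increasing enumeration
  of the real parts, and the embedding of the reals; points of the axis are determined by their real
  parts.\<close>

lemma bvert_bij_betw: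
  assumes "halfplane_graph G"
  shows "bij_betw (bvert G) {1..card (boundary_verts G)} (boundary_verts G)"
proof -
  let ?B = "boundary_verts G"
  have fin: "finite ?B"
    using assms by (auto simp: halfplane_graph_def boundary_verts_def)
  have real: "complex_of_real (Re v) = v" if "v \<in> ?B" for v
    using that by (auto simp: boundary_verts_def axis_def complex_eq_iff)
  have inj: "inj_on Re ?B"
    using real by (metis inj_onI)
  have len: "card (Re ` ?B) = card ?B"
    using inj by (rule card_image)
  have 1: "bij_betw (\<lambda>j. j - 1) {1..card ?B} {..<card ?B}"
    by (rule bij_betwI[of _ _ _ Suc]) auto
  have 2: "bij_betw (\<lambda>i. sorted_list_of_set (Re ` ?B) ! i) {..<card ?B} (Re ` ?B)"
    using fin by (intro bij_betw_nth) (auto simp: len)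
  have 3: "bij_betw complex_of_real (Re ` ?B) ?B"
    using real by (intro bij_betwI[of _ _ _ Re]) auto
  show ?thesis
    using bij_betw_trans[OF bij_betw_trans[OF 1 2] 3]
    by (simp add: bvert_def[abs_def] comp_def)
qed

section \<open>The local replacements\<close>

lemma half_square_iff: "w \<in> half_square \<longleftrightarrow> -1 \<le> Re w \<and> Re w \<le> 1 \<and> -1 \<le> Im w \<and> Im w \<le> 0"
  by (auto simp: half_square_def in_cbox_complex_iff)

lemma convex_half_square: "convex half_square"
  by (simp add: half_square_def)

text \<open>All segments of the local picture lie in the convex square of the chart, whose image
  avoids the axis. Hence replacing a crossing changes nothing at the boundary.\<close>

lemma crossing_replacement_subset:
  assumes "crossing_replacement C z U W \<rho>"
  shows "\<rho> a \<subseteq> U" "W \<subseteq> U" "U \<inter> axis = {}"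
proof -
  have sub: "closed_segment x y \<subseteq> full_square" if "x \<in> full_square" "y \<in> full_square" for x y
    using that by (simp add: full_square_def closed_segment_subset)
  have mem: "Complex (-1) (-1) \<in> full_square" "Complex 1 1 \<in> full_square"
      "Complex 1 (-1) \<in> full_square" "Complex (-1) 1 \<in> full_square"
      "-1/2 \<in> full_square" "1/2 \<in> full_square"
    by (auto simp: full_square_def in_cbox_complex_iff)
  obtain \<psi> b b' where chart: "crossing_chart C b b' z \<psi>"
    and U: "U = \<psi> ` full_square" and W: "W = \<psi> ` {-1/2, 1/2}"
    and b: "\<rho> b = \<psi> ` (closed_segment (Complex (-1) (-1)) (-1/2) \<union> closed_segment (-1/2) (1/2) \<union>
                closed_segment (1/2) (Complex 1 1))"
    and b': "\<rho> b' = \<psi> ` (closed_segment (Complex 1 (-1)) (1/2) \<union> closed_segment (1/2) (-1/2) \<union>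
                 closed_segment (-1/2) (Complex (-1) 1))"
    and other: "\<And>q. q \<notin> {b, b'} \<Longrightarrow> \<rho> q = {}"
    using assms unfolding crossing_replacement_def by blast
  show "\<rho> a \<subseteq> U"
  proof (cases "a \<in> {b, b'}")
    case True
    have "\<rho> b \<subseteq> U"
      unfolding b U by (intro image_mono Un_least sub mem)
    moreover have "\<rho> b' \<subseteq> U"
      unfolding b' U by (intro image_mono Un_least sub mem)
    ultimately show ?thesis
      using True by blast
  qed (simp add: other)
  show "W \<subseteq> U"
    unfolding W U using mem by blast
  show "U \<inter> axis = {}"
    using chart unfolding U crossing_chart_def by blast
qed

text \<open>In the chart the branches stay strictly below the axis, so they keep a positive distance
  from \<open>v\<close>, and a small ball around \<open>v\<close> sees only the trunk. The path
  \<open>p\<close> is the whole trunk.\<close>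

lemma trunk_replacement_near:
  assumes tr: "trunk_replacement C v U W \<rho>" and d: "card (arcs_at C v) > 1"
  shows "\<exists>p \<epsilon>. arc p \<and> pathstart p = v \<and> \<epsilon> > 0 \<and> ball v \<epsilon> \<inter> halfplane \<subseteq> U \<and>
           (\<forall>a\<in>arcs_at C v. \<rho> a \<inter> ball v \<epsilon> \<subseteq> path_image p)"
    and "\<rho> a \<subseteq> U" "\<rho> a \<inter> axis \<subseteq> {v}" "W \<inter> axis = {}"
    and "a \<notin> arcs_at C v \<Longrightarrow> \<rho> a = {}"
proof -
  define d where "d = card (arcs_at C v)"
  define level where "level = (\<lambda>i::nat. Complex 0 (- real i / real d))"
  have "d > 1"
    using d by (simp add: d_def)
  obtain \<psi> t \<kappa> where chart: "boundary_chart C v \<psi> t"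
    and \<kappa>: "\<kappa> ` arcs_at C v = {1..d - 1}"
    and U: "U = \<psi> ` half_square" and W: "W = \<psi> ` level ` {1..d - 1}"
    and \<rho>_arc: "\<forall>a\<in>arcs_at C v. \<rho> a = \<psi> ` (closed_segment 0 (level (\<kappa> a)) \<union>
              closed_segment (level (\<kappa> a)) (Complex (t a) (-1)))"
    and \<rho>0: "\<forall>a. a \<notin> arcs_at C v \<longrightarrow> \<rho> a = {}"
    using tr unfolding trunk_replacement_def Let_def d_def[symmetric] level_def[symmetric]
    by (elim exE conjE) (rule that; (assumption | (unfold level_def, assumption)))
  have \<rho>: "\<rho> a = \<psi> ` (closed_segment 0 (level (\<kappa> a)) \<union>
              closed_segment (level (\<kappa> a)) (Complex (t a) (-1)))" if "a \<in> arcs_at C v" for a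
    using \<rho>_arc that by blast
  have cont: "continuous_on half_square \<psi>" and inj: "inj_on \<psi> half_square" and \<psi>0: "\<psi> 0 = v"
    and \<psi>_axis: "\<And>w. w \<in> half_square \<Longrightarrow> \<psi> w \<in> axis \<longleftrightarrow> w \<in> axis"
    and ball: "\<exists>\<epsilon>>0. ball v \<epsilon> \<inter> halfplane \<subseteq> U"
    and t: "\<And>a. a \<in> arcs_at C v \<Longrightarrow> -1 < t a \<and> t a < 1"
    using chart by (auto simp: boundary_chart_def U)
  have level: "level i \<in> half_square" "Im (level i) < 0" if "i \<in> {1..d - 1}" for i
    using that \<open>d > 1\<close> by (auto simp: level_def half_square_iff field_simps)
  have \<kappa>': "\<kappa> a \<in> {1..d - 1}" if "a \<in> arcs_at C v" for a
    using \<kappa> that by blast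
  have zero: "0 \<in> half_square"
    by (simp add: half_square_iff)
  have trunk: "closed_segment 0 (level i) \<subseteq> half_square" if "i \<in> {1..d - 1}" for i
    using level[OF that] zero by (intro closed_segment_subset convex_half_square)
  \<comment> \<open>The half-square and the open lower half-plane are convex and contain both ends
    of the branch.\<close>
  have branch: "closed_segment (level (\<kappa> a)) (Complex (t a) (-1)) \<subseteq> half_square \<inter> {w. Im w < 0}"
    if "a \<in> arcs_at C v" for a
    using level[OF \<kappa>'[OF that]] t[OF that]
    by (intro closed_segment_subset convex_Int convex_half_square convex_halfspace_Im_lt)
       (auto simp: half_square_iff)
  show "\<rho> a \<subseteq> U" for a
  proof (cases "a \<in> arcs_at C v")
    case True
    have "closed_segment 0 (level (\<kappa> a)) \<union> closed_segment (level (\<kappa> a)) (Complex (t a) (-1))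
        \<subseteq> half_square"
      using trunk[OF \<kappa>'[OF True]] branch[OF True] by blast
    then show ?thesis
      unfolding \<rho>[OF True] U by (rule image_mono)
  qed (simp add: \<rho>0)
  show "W \<inter> axis = {}"
    using level \<psi>_axis by (force simp: W axis_def)
  show "\<rho> a \<inter> axis \<subseteq> {v}" for a
  proof (cases "a \<in> arcs_at C v")
    case True
    \<comment> \<open>A segment from 0 to a point below the axis meets the axis only in 0.\<close>
    have "\<psi> w = v" if w: "w \<in> closed_segment 0 (level (\<kappa> a))" "\<psi> w \<in> axis" for w
    proof -
      have "Im w = 0"
        using w trunk[OF \<kappa>'[OF True]] \<psi>_axis by (auto simp: axis_def)
      moreover have "Im (level (\<kappa> a)) \<noteq> 0"
        using level[OF \<kappa>'[OF True]] by simp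
      ultimately have "w = 0"
        using w(1) by (auto simp: closed_segment_def)
      then show ?thesis
        by (simp add: \<psi>0)
    qed
    moreover have "\<psi> w \<notin> axis" if "w \<in> closed_segment (level (\<kappa> a)) (Complex (t a) (-1))" for w
    proof -
      have "w \<in> half_square" "Im w < 0"
        using that branch[OF True] by blast+
      then show ?thesis
        using \<psi>_axis by (auto simp: axis_def)
    qed
    ultimately show ?thesis
      by (auto simp: \<rho> True)
  qed (simp add: \<rho>0)
  show "a \<notin> arcs_at C v \<Longrightarrow> \<rho> a = {}" for a
    using \<rho>0 by blast
  \<comment> \<open>The union of all branches is compact, being a finite union of images of
    segments, so the complement of \<open>K\<close> is an open neighbourhood of
    \<open>v\<close>.\<close>
  define K where "K = (\<Union>a\<in>arcs_at C v. \<psi> ` closed_segment (level (\<kappa> a)) (Complex (t a) (-1)))"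
  \<comment> \<open>An infinite set would have \<open>card\<close> 0.\<close>
  have "finite (arcs_at C v)"
    using d card.infinite by fastforce
  then have "compact K"
    unfolding K_def using branch
    by (intro compact_UN compact_continuous_image continuous_on_subset[OF cont]) auto
  moreover have "v \<notin> K"
  proof
    assume "v \<in> K"
    then obtain a w where "a \<in> arcs_at C v" "\<psi> w = \<psi> 0"
        "w \<in> closed_segment (level (\<kappa> a)) (Complex (t a) (-1))"
      by (auto simp: K_def \<psi>0)
    then show False
      using branch[of a] inj_onD[OF inj, of w 0] zero by (auto dest!: subsetD)
  qed
  ultimately obtain \<epsilon>1 where \<epsilon>1: "\<epsilon>1 > 0" "ball v \<epsilon>1 \<subseteq> - K"
    by (metis compact_imp_closed open_Compl open_contains_ball ComplI)
  obtain \<epsilon>2 where \<epsilon>2: "\<epsilon>2 > 0" "ball v \<epsilon>2 \<inter> halfplane \<subseteq> U"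
    using ball by blast
  define p where "p = \<psi> \<circ> linepath 0 (level (d - 1))"
  have low: "d - 1 \<in> {1..d - 1}"
    using \<open>d > 1\<close> by auto
  have "arc (linepath 0 (level (d - 1)))"
    using level(2)[OF low] by (intro arc_linepath) auto
  moreover have "inj_on \<psi> (path_image (linepath 0 (level (d - 1))))"
    "continuous_on (path_image (linepath 0 (level (d - 1)))) \<psi>"
    using trunk[OF low] inj_on_subset[OF inj] continuous_on_subset[OF cont] by auto
  ultimately have "arc p"
    unfolding p_def arc_def path_image_def
    by (simp add: comp_inj_on path_continuous_image path_image_def)
  moreover have "pathstart p = v"
    by (simp add: p_def pathstart_compose \<psi>0)
  moreover have "\<rho> a \<inter> ball v (min \<epsilon>1 \<epsilon>2) \<subseteq> path_image p" if a: "a \<in> arcs_at C v" for a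
  proof -
    have "\<rho> a \<inter> ball v (min \<epsilon>1 \<epsilon>2) \<subseteq> \<psi> ` closed_segment 0 (level (\<kappa> a))"
    proof -
      have "\<psi> ` closed_segment (level (\<kappa> a)) (Complex (t a) (-1)) \<subseteq> K"
        using a by (auto simp: K_def)
      then show ?thesis
        using \<epsilon>1(2) unfolding \<rho>[OF a] image_Un by fastforce
    qed
    \<comment> \<open>The levels are equally spaced, so level \<open>\<kappa> a\<close> sits at the
      fraction \<open>\<kappa> a / (d - 1)\<close> of the trunk.\<close>
    moreover have "level (\<kappa> a) \<in> closed_segment 0 (level (d - 1))"
      unfolding in_segment using \<kappa>'[OF a] \<open>d > 1\<close>
      by (intro exI[of _ "real (\<kappa> a) / real (d - 1)"]) (auto simp: level_def complex_eq_iff)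
    ultimately show ?thesis
      unfolding p_def path_image_compose path_image_linepath
      by (meson closed_segment_subset convex_closed_segment ends_in_segment(1) image_mono order_trans)
  qed
  ultimately show "\<exists>p \<epsilon>. arc p \<and> pathstart p = v \<and> \<epsilon> > 0 \<and> ball v \<epsilon> \<inter> halfplane \<subseteq> U \<and>
           (\<forall>a\<in>arcs_at C v. \<rho> a \<inter> ball v \<epsilon> \<subseteq> path_image p)"
    using \<epsilon>1(1) \<epsilon>2 by (intro exI[of _ p] exI[of _ "min \<epsilon>1 \<epsilon>2"]) auto
qed

section \<open>The web near the boundary\<close>

text \<open>The witnesses \<open>U\<close>, \<open>W\<close>, \<open>\<rho>\<close>,
  \<open>f\<close> hidden in \<open>web_and_stranding_of\<close>, and its local abbreviations
  \<open>B\<close> and \<open>R\<close>, are fixed here once for all the lemmas that follow.\<close>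

locale matching_web =
  fixes n m :: nat and T :: "nat list list"
    and M :: halfplane_graph and C :: "colored_curve set"
    and G :: weighted_graph and S :: "colored_curve set"
    and U W :: "complex \<Rightarrow> complex set" and \<rho> :: "complex \<Rightarrow> colored_curve \<Rightarrow> complex set"
    and f :: "colored_curve \<Rightarrow> real \<Rightarrow> complex" and B R :: "complex set"
  assumes matching: "colored_noncrossing_matching n m T M C"
    and B: "B = {v\<in>boundary_verts M. card (arcs_at C v) > 1}"
    and R: "R = interior_verts M \<union> B"
    and crossings: "\<And>z. z \<in> interior_verts M \<Longrightarrow> crossing_replacement C z (U z) (W z) (\<rho> z)"
    and trunks: "\<And>v. v \<in> B \<Longrightarrow> trunk_replacement C v (U v) (W v) (\<rho> v)"
    and disjoint: "disjoint_family_on U R"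
    and rerouted: "\<And>a. a \<in> C \<Longrightarrow> arc (f a)"
      "\<And>a. a \<in> C \<Longrightarrow> pathstart (f a) = pathstart (snd a)"
      "\<And>a. a \<in> C \<Longrightarrow> pathfinish (f a) = pathfinish (snd a)"
      "\<And>a. a \<in> C \<Longrightarrow>
        path_image (f a) = (path_image (snd a) - (\<Union>z\<in>R. U z)) \<union> (\<Union>z\<in>R. \<rho> z a)"
    and S: "S = (\<lambda>a. (fst a, f a)) ` C"
    and G: "halfplane_graph G"
    and verts_G: "verts G = boundary_verts M \<union> (\<Union>z\<in>R. W z)"
    and curves_G: "curve_system G (snd ` S)"
    and edges_G: "\<And>e. e \<in> edges G \<Longrightarrow> colors_on S e \<noteq> {}"
      "\<And>e. e \<in> edges G \<Longrightarrow> Max (colors_on S e) \<in> colors_with S e"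
begin

section \<open>Arcs of the matching and their rerouting\<close>

lemma M: "halfplane_graph M" "card (boundary_verts M) = m"
  using matching by (auto simp: colored_noncrossing_matching_def)

lemma boundary_on_axis: "v \<in> boundary_verts M \<Longrightarrow> v \<in> axis"
  by (simp add: boundary_verts_def)

text \<open>All new vertices lie off the axis: those of a crossing inside its neighbourhood, those
  of a trunk at positive depth.\<close>

lemma boundary_verts_G: "boundary_verts G = boundary_verts M"
proof -
  have "W z \<inter> axis = {}" if "z \<in> R" for z
    using that crossing_replacement_subset(2,3)[OF crossings] trunk_replacement_near(4)[OF trunks]
    unfolding R B by blast
  then show ?thesis
    unfolding boundary_verts_def[of G] verts_G using boundary_on_axis by blast
qed

lemma bvert_G: "bvert G = bvert M"
  by (simp add: bvert_def[abs_def] boundary_verts_G)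

lemma C_arc:
  assumes "a \<in> C"
  shows "fst a \<in> {1..<n}" "arc (snd a)"
    "path_image (snd a) \<inter> axis = {pathstart (snd a), pathfinish (snd a)}"
    "\<exists>i\<in>{1..m}. \<exists>j\<in>{1..m}. pathstart (snd a) = bvert M j \<and> pathfinish (snd a) = bvert M i"
proof -
  obtain c p where "a = (c, p)"
    by force
  moreover have "\<forall>(c, p)\<in>C. c \<in> {1..<n} \<and> arc p \<and> path_image p \<inter> axis = {pathstart p, pathfinish p} \<and>
        (\<exists>a\<in>{1..m}. \<exists>b\<in>{1..m}. pathstart p = bvert M b \<and> pathfinish p = bvert M a)"
    using matching by (simp add: colored_noncrossing_matching_def)
  ultimately show "fst a \<in> {1..<n}" "arc (snd a)"
    "path_image (snd a) \<inter> axis = {pathstart (snd a), pathfinish (snd a)}"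
    "\<exists>i\<in>{1..m}. \<exists>j\<in>{1..m}. pathstart (snd a) = bvert M j \<and> pathfinish (snd a) = bvert M i"
    using assms by auto
qed

lemma arcs_at_iff: "a \<in> C \<Longrightarrow> v \<in> axis \<Longrightarrow> a \<in> arcs_at C v \<longleftrightarrow> v \<in> path_image (snd a)"
  using eqset_imp_iff[OF C_arc(3)[of a], of v] by (auto simp: arcs_at_def out_arcs_def in_arcs_def)

lemma arcs_at_subset: "arcs_at C v \<subseteq> C"
  by (auto simp: arcs_at_def out_arcs_def in_arcs_def)

lemma rerouted_ends:
  "a \<in> C \<Longrightarrow> a \<in> arcs_at C v \<longleftrightarrow> v \<in> {pathstart (f a), pathfinish (f a)}"
  using rerouted(2,3)[of a] by (auto simp: arcs_at_def out_arcs_def in_arcs_def)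

text \<open>Arcs of the same color are disjoint, so the arcs at \<open>v\<close> have pairwise
  different colors, all below \<open>n\<close>.\<close>

lemma finite_arcs_at:
  assumes v: "v \<in> boundary_verts M"
  shows "finite (arcs_at C v)"
proof -
  have same: "\<forall>a\<in>C. \<forall>a'\<in>C. a \<noteq> a' \<and> fst a = fst a' \<longrightarrow>
        path_image (snd a) \<inter> path_image (snd a') = {}"
    using matching by (simp add: colored_noncrossing_matching_def)
  have "inj_on fst (arcs_at C v)"
  proof (rule inj_onI)
    fix a a' assume a: "a \<in> arcs_at C v" "a' \<in> arcs_at C v" "fst a = fst a'"
    then have "a \<in> C" "a' \<in> C" "v \<in> path_image (snd a) \<inter> path_image (snd a')"
      using arcs_at_subset arcs_at_iff boundary_on_axis[OF v] by blast+
    then show "a = a'"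
      using same a(3) by blast
  qed
  moreover have "fst ` arcs_at C v \<subseteq> {1..<n}"
    using C_arc(1) arcs_at_subset by blast
  ultimately show ?thesis
    by (meson finite_atLeastLessThan finite_imageD finite_subset)
qed

text \<open>Rerouting creates no new contact with the axis: crossing pieces avoid it, and a trunk
  piece touches it only at the vertex where its own arc already ends.\<close>

lemma rerouted_meets_boundary:
  assumes a: "a \<in> C" and v: "v \<in> axis" and "v \<in> path_image (f a)"
  shows "a \<in> arcs_at C v"
proof -
  consider "v \<in> path_image (snd a)" | z where "z \<in> R" "v \<in> \<rho> z a"
    using assms(3) rerouted(4)[OF a] by blast
  then show ?thesis
  proof cases
    case 1
    then show ?thesis
      using arcs_at_iff[OF a v] by blast
  next
    case 2
    have "z \<notin> interior_verts M"
      using 2 v crossing_replacement_subset(1,3)[OF crossings] by blast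
    then have z: "z \<in> B"
      using 2 by (simp add: R)
    then have card: "card (arcs_at C z) > 1"
      by (simp add: B)
    have "v = z"
      using 2(2) v trunk_replacement_near(3)[OF trunks[OF z] card] by blast
    moreover have "a \<in> arcs_at C z"
      using 2(2) trunk_replacement_near(5)[OF trunks[OF z] card] by blast
    ultimately show ?thesis
      by simp
  qed
qed

text \<open>Inside \<open>U v\<close> the old course of the arc has been removed, and the pieces
  inserted at other places lie in neighbourhoods disjoint from \<open>U v\<close>.\<close>

lemma rerouted_in_trunk:
  assumes a: "a \<in> C" and v: "v \<in> B"
  shows "path_image (f a) \<inter> U v \<subseteq> \<rho> v a"
proof
  fix x assume x: "x \<in> path_image (f a) \<inter> U v"
  have vR: "v \<in> R"
    using v by (simp add: R)
  then obtain z where z: "z \<in> R" "x \<in> \<rho> z a"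
    using x rerouted(4)[OF a] by blast
  have "\<rho> z a \<subseteq> U z"
  proof (cases "z \<in> B")
    case True
    then show ?thesis
      using trunk_replacement_near(2)[OF trunks] by (auto simp: B)
  next
    case False
    then show ?thesis
      using z crossing_replacement_subset(1)[OF crossings] by (auto simp: R)
  qed
  then have "z = v"
    using z x vR disjoint by (auto simp: disjoint_family_on_def)
  then show "x \<in> \<rho> v a"
    using z by simp
qed

section \<open>Uniqueness of the boundary edge\<close>

lemma edge_props:
  assumes "e \<in> edges G"
  shows "arc e" "path_image e \<subseteq> halfplane"
    "path_image e \<inter> axis \<subseteq> {pathstart e, pathfinish e}"
  using G assms by (auto simp: halfplane_graph_def)

lemma edge_ends_iff:
  assumes "e \<in> edges G" "v \<in> boundary_verts M"
  shows "v \<in> {pathstart e, pathfinish e} \<longleftrightarrow> v \<in> path_image e"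
  using edge_props(3)[OF assms(1)] boundary_on_axis[OF assms(2)] by auto

lemma colors_with_iff:
  "c \<in> colors_with S e \<longleftrightarrow> (\<exists>a\<in>C. fst a = c \<and> traverses (f a) e)"
  using rerouted(1) by (force simp: colors_with_def S arc_directed_with)

lemma colors_against_iff:
  "c \<in> colors_against S e \<longleftrightarrow> (\<exists>a\<in>C. fst a = c \<and> traverses (f a) (reversepath e))"
  using rerouted(1) by (force simp: colors_against_def S arc_directed_with)

text \<open>Every edge carries a color, and a strand running with or against the edge contains its
  image.\<close>

lemma edge_on_rerouted:
  assumes "e \<in> edges G"
  shows "\<exists>a\<in>C. path_image e \<subseteq> path_image (f a)"
proof -
  obtain c where "c \<in> colors_with S e \<or> c \<in> colors_against S e"
    using edges_G(1)[OF assms] by (auto simp: colors_on_def)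
  then show ?thesis
    unfolding colors_with_iff colors_against_iff
    using traverses_path_image path_image_reversepath by metis
qed

text \<open>All edges at \<open>v\<close> have an initial piece of one arc in common: of the trunk, or of the single
  rerouted arc that ends at \<open>v\<close>.\<close>

lemma common_germ:
  assumes v: "v \<in> boundary_verts M" and ne: "arcs_at C v \<noteq> {}"
  shows "\<exists>p. arc p \<and>
    (\<forall>e\<in>edges G. v \<in> path_image e \<longrightarrow> (\<exists>\<delta>. 0 < \<delta> \<and> \<delta> \<le> 1 \<and> p ` {0..\<delta>} \<subseteq> path_image e))"
proof (cases "v \<in> B")
  case False
  have "card (arcs_at C v) = 1"
    using False v ne card_gt_0_iff[of "arcs_at C v"] finite_arcs_at[OF v] by (auto simp: B)
  then obtain a where a: "arcs_at C v = {a}"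
    by (auto simp: card_1_singleton_iff)
  then have aC: "a \<in> C"
    using arcs_at_subset by blast
  have fin: "v \<in> {pathstart (f a), pathfinish (f a)}"
    using a rerouted_ends[OF aC] by blast
  \<comment> \<open>The single arc at \<open>v\<close>, parametrised away from
    \<open>v\<close>.\<close>
  define p where "p = (if pathstart (f a) = v then f a else reversepath (f a))"
  have p: "arc p" "pathstart p = v" "path_image p = path_image (f a)"
    using fin rerouted(1)[OF aC] by (auto simp: p_def arc_reversepath)
  have "\<exists>\<delta>. 0 < \<delta> \<and> \<delta> \<le> 1 \<and> p ` {0..\<delta>} \<subseteq> path_image e"
    if e: "e \<in> edges G" "v \<in> path_image e" for e
  proof -
    obtain a' where a': "a' \<in> C" "path_image e \<subseteq> path_image (f a')"
      using edge_on_rerouted[OF e(1)] by blast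
    then have "a' = a"
      using rerouted_meets_boundary[OF a'(1) boundary_on_axis[OF v]] e(2) a by blast
    then have sub: "path_image e \<subseteq> path_image p"
      using a' p by simp
    obtain x where "x \<in> path_image e" "x \<noteq> v"
      using arc_distinct_ends[OF edge_props(1)[OF e(1)]]
      by (metis pathfinish_in_path_image pathstart_in_path_image)
    then show ?thesis
      using connected_in_arc_initial[OF p(1) _ sub] edge_props(1)[OF e(1)] e(2) p(2)
      by (simp add: connected_arc_image)
  qed
  then show ?thesis
    using p(1) by blast
next
  case True
  then have card: "card (arcs_at C v) > 1"
    by (simp add: B)
  obtain p \<epsilon> where p: "arc p" "pathstart p = v" and \<epsilon>: "\<epsilon> > 0" "ball v \<epsilon> \<inter> halfplane \<subseteq> U v"
    and near: "\<forall>a\<in>arcs_at C v. \<rho> v a \<inter> ball v \<epsilon> \<subseteq> path_image p"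
    using trunk_replacement_near(1)[OF trunks[OF True] card] by blast
  have "\<exists>\<delta>. 0 < \<delta> \<and> \<delta> \<le> 1 \<and> p ` {0..\<delta>} \<subseteq> path_image e"
    if e: "e \<in> edges G" "v \<in> path_image e" for e
  proof -
    obtain a where a: "a \<in> C" "path_image e \<subseteq> path_image (f a)"
      using edge_on_rerouted[OF e(1)] by blast
    have a_at: "a \<in> arcs_at C v"
      using rerouted_meets_boundary[OF a(1) boundary_on_axis[OF v]] e(2) a by blast
    define q where "q = (if pathstart e = v then e else reversepath e)"
    have q: "arc q" "pathstart q = v" "path_image q = path_image e"
      using edge_ends_iff[OF e(1) v] e(2) edge_props(1)[OF e(1)]
      by (auto simp: q_def arc_reversepath)
    then have "continuous_on {0..1} q" "q 0 = v"
      by (auto simp: arc_def path_def pathstart_def)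
    then obtain d where d: "d > 0" "\<And>x. x \<in> {0..1} \<Longrightarrow> dist x 0 < d \<Longrightarrow> dist (q x) v < \<epsilon>"
      using \<epsilon>(1) unfolding continuous_on_iff by (metis atLeastAtMost_iff order_refl zero_le_one)
    \<comment> \<open>Halving \<open>d\<close> gives the strict inequality \<open>s < d\<close>; the
      minimum keeps \<open>s\<close> in the domain of \<open>q\<close>.\<close>
    define s where "s = min 1 (d / 2)"
    have s: "0 < s" "s \<le> 1" "s < d"
      using d(1) by (auto simp: s_def)
    have near_v: "q ` {0..s} \<subseteq> path_image e \<inter> ball v \<epsilon>"
    proof (rule image_subsetI)
      fix x assume "x \<in> {0..s}"
      then have "x \<in> {0..1}" "dist x 0 < d"
        using s by auto
      then show "q x \<in> path_image e \<inter> ball v \<epsilon>"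
        using d(2)[of x] q(3) by (auto simp: path_image_def dist_commute)
    qed
    \<comment> \<open>This piece of the edge lies in the half-plane and near \<open>v\<close>, hence
      in \<open>U v\<close>, hence on the inserted part \<open>\<rho> v a\<close>, of which only
      trunk points are that near to \<open>v\<close>.\<close>
    then have "q ` {0..s} \<subseteq> path_image p"
    proof -
      have "q ` {0..s} \<subseteq> path_image (f a) \<inter> U v"
        using near_v a(2) edge_props(2)[OF e(1)] \<epsilon>(2) by blast
      then have "q ` {0..s} \<subseteq> \<rho> v a"
        using rerouted_in_trunk[OF a(1) True] by (rule order_trans)
      then show ?thesis
        using near a_at near_v by blast
    qed
    moreover have "connected (q ` {0..s})"
      using s
      by (intro connected_continuous_image continuous_on_subset[OF \<open>continuous_on {0..1} q\<close>]) auto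
    moreover have "q s \<noteq> v"
      using inj_onD[of q "{0..1}" s 0] q(1,2) s by (auto simp: arc_def pathstart_def)
    moreover have "pathstart p \<in> q ` {0..s}"
      using s p(2) \<open>q 0 = v\<close> by (intro image_eqI[of _ _ 0]) auto
    moreover have "q s \<in> q ` {0..s}"
      using s by auto
    ultimately have "\<exists>\<delta>. 0 < \<delta> \<and> \<delta> \<le> 1 \<and> p ` {0..\<delta>} \<subseteq> q ` {0..s}"
      unfolding p(2)[symmetric] by (intro connected_in_arc_initial[OF p(1)])
    moreover have "q ` {0..s} \<subseteq> path_image e"
      using near_v by blast
    ultimately show ?thesis
      by blast
  qed
  then show ?thesis
    using p(1) by blast
qed

text \<open>Existence: a rerouted arc ending at \<open>v\<close> is a union of edges, one of which
  contains \<open>v\<close>. Uniqueness: two edges at \<open>v\<close> share an infinite germ,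
  whereas distinct edges meet in vertices only. The unique edge then lies on every rerouted arc at
  \<open>v\<close>.\<close>

lemma edge_at_boundary:
  assumes v: "v \<in> boundary_verts M" and ne: "arcs_at C v \<noteq> {}"
  shows "edge_at G v \<in> edges G" "v \<in> {pathstart (edge_at G v), pathfinish (edge_at G v)}"
    "\<And>a. a \<in> arcs_at C v \<Longrightarrow> path_image (edge_at G v) \<subseteq> path_image (f a)"
proof -
  obtain p where p: "arc p" and germ: "\<And>e. e \<in> edges G \<Longrightarrow> v \<in> path_image e \<Longrightarrow>
      \<exists>\<delta>. 0 < \<delta> \<and> \<delta> \<le> 1 \<and> p ` {0..\<delta>} \<subseteq> path_image e"
    using common_germ[OF assms] by blast
  have unique: "e = e'"
    if e: "e \<in> edges G" "v \<in> path_image e" and e': "e' \<in> edges G" "v \<in> path_image e'" for e e'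
  proof (rule ccontr)
    assume "e \<noteq> e'"
    then have "path_image e \<inter> path_image e' \<subseteq> verts G"
      using G e e' by (auto simp: halfplane_graph_def)
    then have "finite (path_image e \<inter> path_image e')"
      using G by (auto simp: halfplane_graph_def intro: finite_subset)
    moreover obtain \<delta> where \<delta>: "0 < \<delta>" "\<delta> \<le> 1" "p ` {0..\<delta>} \<subseteq> path_image e"
      using germ[OF e] by blast
    moreover obtain \<delta>' where \<delta>': "0 < \<delta>'" "\<delta>' \<le> 1" "p ` {0..\<delta>'} \<subseteq> path_image e'"
      using germ[OF e'] by blast
    moreover have "p ` {0..min \<delta> \<delta>'} \<subseteq> path_image e \<inter> path_image e'"
      using \<delta>(3) \<delta>'(3) by fastforce
    moreover have "infinite (p ` {0..min \<delta> \<delta>'})"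
      using \<delta>(1,2) \<delta>'(1) by (intro arc_initial_infinite[OF p]) auto
    ultimately show False
      using finite_subset by blast
  qed
  have exists: "\<exists>e\<in>edges G. v \<in> path_image e \<and> path_image e \<subseteq> path_image (f a)"
    if a: "a \<in> arcs_at C v" for a
  proof -
    have aC: "a \<in> C"
      using a arcs_at_subset by blast
    then have "f a \<in> snd ` S"
      by (force simp: S)
    then obtain F where F: "F \<subseteq> edges G" "path_image (f a) = (\<Union>e\<in>F. path_image e)"
      using curves_G by (auto simp: curve_system_def)
    have "v \<in> path_image (f a)"
      using a rerouted_ends[OF aC] by auto
    then show ?thesis
      using F by blast
  qed
  obtain a where "a \<in> arcs_at C v"
    using ne by blast
  then obtain e where e: "e \<in> edges G" "v \<in> path_image e"
    using exists by blast
  have edge: "edge_at G v = e"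
    unfolding edge_at_def using e unique edge_ends_iff[OF _ v] by (intro the_equality) blast+
  show "edge_at G v \<in> edges G" "v \<in> {pathstart (edge_at G v), pathfinish (edge_at G v)}"
    unfolding edge using e edge_ends_iff[OF e(1) v] by blast+
  show "path_image (edge_at G v) \<subseteq> path_image (f a)" if "a \<in> arcs_at C v" for a
    unfolding edge using exists[OF that] unique e by blast
qed

section \<open>Strands on the boundary edge\<close>

text \<open>An arc through \<open>e\<close> contains \<open>v\<close>, so it ends there, and
  traversing \<open>e\<close> away from \<open>v\<close> makes \<open>v\<close> its start. Stated
  for any suitable arc \<open>e\<close>, so that it applies to the boundary edge and to its
  reversal.\<close>

lemma colors_from_boundary:
  assumes v: "v \<in> boundary_verts M" and e: "arc e" "pathstart e = v"
    and sub: "\<And>a. a \<in> arcs_at C v \<Longrightarrow> path_image e \<subseteq> path_image (f a)"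
  shows "{c. \<exists>a\<in>C. fst a = c \<and> traverses (f a) e} = fst ` out_arcs C v"
proof -
  have "traverses (f a) e \<longleftrightarrow> a \<in> out_arcs C v" if a: "a \<in> C" for a
  proof
    assume tr: "traverses (f a) e"
    have "a \<in> arcs_at C v"
      using traverses_path_image[OF tr] e(2) a boundary_on_axis[OF v]
      by (intro rerouted_meets_boundary) auto
    then have "pathstart e = pathstart (f a)"
      using rerouted_ends[OF a] e(2) by (intro traverses_pathstart_eq[OF rerouted(1)[OF a] tr]) auto
    then show "a \<in> out_arcs C v"
      using a e(2) rerouted(2)[OF a] by (simp add: out_arcs_def)
  next
    assume "a \<in> out_arcs C v"
    then show "traverses (f a) e"
      using a e sub[of a] rerouted(1,2)[OF a]
      by (intro arc_traverses_subarc) (auto simp: out_arcs_def arcs_at_def)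
  qed
  moreover have "out_arcs C v \<subseteq> C"
    by (auto simp: out_arcs_def)
  ultimately show ?thesis
    by blast
qed

text \<open>The mirror image of \<open>colors_from_boundary\<close>, with starts and finishes
  exchanged.\<close>

lemma colors_into_boundary:
  assumes v: "v \<in> boundary_verts M" and e: "arc e" "pathfinish e = v"
    and sub: "\<And>a. a \<in> arcs_at C v \<Longrightarrow> path_image e \<subseteq> path_image (f a)"
  shows "{c. \<exists>a\<in>C. fst a = c \<and> traverses (f a) e} = fst ` in_arcs C v"
proof -
  have "traverses (f a) e \<longleftrightarrow> a \<in> in_arcs C v" if a: "a \<in> C" for a
  proof
    assume tr: "traverses (f a) e"
    have "a \<in> arcs_at C v"
      using traverses_path_image[OF tr] e(2) a boundary_on_axis[OF v]
      by (intro rerouted_meets_boundary) auto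
    then have "pathfinish e = pathfinish (f a)"
      using rerouted_ends[OF a] e(2) by (intro traverses_pathfinish_eq[OF rerouted(1)[OF a] tr]) auto
    then show "a \<in> in_arcs C v"
      using a e(2) rerouted(3)[OF a] by (simp add: in_arcs_def)
  next
    assume "a \<in> in_arcs C v"
    then show "traverses (f a) e"
      using a e sub[of a] rerouted(1,3)[OF a]
      by (intro arc_traverses_subarc_finish) (auto simp: in_arcs_def arcs_at_def)
  qed
  moreover have "in_arcs C v \<subseteq> C"
    by (auto simp: in_arcs_def)
  ultimately show ?thesis
    by blast
qed

section \<open>Colors of the arcs at a boundary vertex, read off from the rows\<close>

lemma matched:
  assumes "c \<in> {1..<n}"
  shows "noncrossing_matching (in_endpoints m T c) (out_endpoints m T c)
        {(a, b). a \<in> {1..m} \<and> b \<in> {1..m} \<and>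
           (\<exists>p. (c, p) \<in> C \<and> pathstart p = bvert M b \<and> pathfinish p = bvert M a)}"
proof -
  have "\<forall>c\<in>{1..<n}. noncrossing_matching (in_endpoints m T c) (out_endpoints m T c)
        {(a, b). a \<in> {1..m} \<and> b \<in> {1..m} \<and>
           (\<exists>p. (c, p) \<in> C \<and> pathstart p = bvert M b \<and> pathfinish p = bvert M a)}"
    using matching unfolding colored_noncrossing_matching_def by (elim conjE) assumption
  then show ?thesis
    using assms by (rule bspec)
qed

lemma matched_endpoints:
  assumes "(c, p) \<in> C" "pathstart p = bvert M b" "pathfinish p = bvert M a"
    and "a \<in> {1..m}" "b \<in> {1..m}"
  shows "a \<in> in_endpoints m T c" "b \<in> out_endpoints m T c"
proof -
  let ?P = "{(a, b). a \<in> {1..m} \<and> b \<in> {1..m} \<and>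
           (\<exists>p. (c, p) \<in> C \<and> pathstart p = bvert M b \<and> pathfinish p = bvert M a)}"
  have "c \<in> {1..<n}"
    using C_arc(1)[OF assms(1)] by simp
  then have "?P \<subseteq> in_endpoints m T c \<times> out_endpoints m T c"
    using matched by (simp only: noncrossing_matching_def)
  moreover have "(a, b) \<in> ?P"
    using assms by blast
  ultimately show "a \<in> in_endpoints m T c" "b \<in> out_endpoints m T c"
    by blast+
qed

lemma in_endpoint_matched:
  assumes c: "c \<in> {1..<n}" and "a \<in> in_endpoints m T c"
  shows "\<exists>p. (c, p) \<in> C \<and> pathfinish p = bvert M a"
proof -
  have "\<forall>a\<in>in_endpoints m T c. \<exists>!b. (a, b) \<in> {(a, b). a \<in> {1..m} \<and> b \<in> {1..m} \<and>
           (\<exists>p. (c, p) \<in> C \<and> pathstart p = bvert M b \<and> pathfinish p = bvert M a)}"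
    using matched[OF c] unfolding noncrossing_matching_def by (elim conjE) assumption
  then have "\<exists>b. (a, b) \<in> {(a, b). a \<in> {1..m} \<and> b \<in> {1..m} \<and>
           (\<exists>p. (c, p) \<in> C \<and> pathstart p = bvert M b \<and> pathfinish p = bvert M a)}"
    using assms(2) by (intro ex1_implies_ex) (rule bspec)
  then show ?thesis
    by auto
qed

lemma out_endpoint_matched:
  assumes c: "c \<in> {1..<n}" and "b \<in> out_endpoints m T c"
  shows "\<exists>p. (c, p) \<in> C \<and> pathstart p = bvert M b"
proof -
  have "\<forall>b\<in>out_endpoints m T c. \<exists>!a. (a, b) \<in> {(a, b). a \<in> {1..m} \<and> b \<in> {1..m} \<and>
           (\<exists>p. (c, p) \<in> C \<and> pathstart p = bvert M b \<and> pathfinish p = bvert M a)}"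
    using matched[OF c] unfolding noncrossing_matching_def by (elim conjE) assumption
  then have "\<exists>a. (a, b) \<in> {(a, b). a \<in> {1..m} \<and> b \<in> {1..m} \<and>
           (\<exists>p. (c, p) \<in> C \<and> pathstart p = bvert M b \<and> pathfinish p = bvert M a)}"
    using assms(2) by (intro ex1_implies_ex) (rule bspec)
  then show ?thesis
    by auto
qed

text \<open>Each arc of \<open>C\<close> realizes a pair of the matching, so its finish is an
  in-endpoint; conversely the matching covers every in-endpoint.\<close>

lemma in_arc_colors:
  assumes j: "j \<in> {1..m}"
  shows "fst ` in_arcs C (bvert M j) = {c\<in>{1..<n}. j \<in> row T c \<and> j \<notin> row T (c + 1)}"
proof (intro set_eqI iffI)
  fix c assume "c \<in> fst ` in_arcs C (bvert M j)"
  then obtain p where p: "(c, p) \<in> C" "pathfinish p = bvert M j"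
    by (auto simp: in_arcs_def)
  then obtain b where "b \<in> {1..m}" "pathstart p = bvert M b"
    using C_arc(4) by fastforce
  moreover have c: "c \<in> {1..<n}"
    using C_arc(1) p by fastforce
  ultimately have "j \<in> in_endpoints m T c"
    using matched_endpoints(1)[OF p(1)] p(2) j by blast
  then show "c \<in> {c\<in>{1..<n}. j \<in> row T c \<and> j \<notin> row T (c + 1)}"
    using c by (simp add: in_endpoints_def)
next
  fix c assume "c \<in> {c\<in>{1..<n}. j \<in> row T c \<and> j \<notin> row T (c + 1)}"
  then have c: "c \<in> {1..<n}" and "j \<in> in_endpoints m T c"
    using j by (auto simp: in_endpoints_def)
  then obtain p where "(c, p) \<in> C" "pathfinish p = bvert M j"
    using in_endpoint_matched[OF c] by blast
  then show "c \<in> fst ` in_arcs C (bvert M j)"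
    by (force simp: in_arcs_def)
qed

lemma out_arc_colors:
  assumes j: "j \<in> {1..m}"
  shows "fst ` out_arcs C (bvert M j) = {c\<in>{1..<n}. j \<notin> row T c \<and> j \<in> row T (c + 1)}"
proof (intro set_eqI iffI)
  fix c assume "c \<in> fst ` out_arcs C (bvert M j)"
  then obtain p where p: "(c, p) \<in> C" "pathstart p = bvert M j"
    by (auto simp: out_arcs_def)
  then obtain a where "a \<in> {1..m}" "pathfinish p = bvert M a"
    using C_arc(4) by fastforce
  moreover have c: "c \<in> {1..<n}"
    using C_arc(1) p by fastforce
  ultimately have "j \<in> out_endpoints m T c"
    using matched_endpoints(2)[OF p(1)] p(2) j by blast
  then show "c \<in> {c\<in>{1..<n}. j \<notin> row T c \<and> j \<in> row T (c + 1)}"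
    using c by (simp add: out_endpoints_def)
next
  fix c assume "c \<in> {c\<in>{1..<n}. j \<notin> row T c \<and> j \<in> row T (c + 1)}"
  then have c: "c \<in> {1..<n}" and "j \<in> out_endpoints m T c"
    using j by (auto simp: out_endpoints_def)
  then obtain p where "(c, p) \<in> C" "pathstart p = bvert M j"
    using out_endpoint_matched[OF c] by blast
  then show "c \<in> fst ` out_arcs C (bvert M j)"
    by (force simp: out_arcs_def)
qed

section \<open>Recovering the tableau\<close>

text \<open>If the boundary edge points to the axis, the in-arcs run with it and its vector
  indicates the rows containing \<open>j\<close>. If it points away, in- and out-arcs change roles,
  the vector indicates the complementary rows, and the complement taken in
  \<open>boundary_vector\<close> undoes this.\<close>

lemma boundary_vector_eq_indicator:
  assumes j: "j \<in> {1..m}" and change: "\<exists>c\<in>{1..<n}. (j \<in> row T c) \<noteq> (j \<in> row T (c + 1))"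
    and c: "c \<in> {1..n}"
  shows "boundary_vector n G S j c = (if j \<in> row T c then 1 else 0)"
proof -
  define v where "v = bvert M j"
  define e where "e = edge_at G v"
  have v: "v \<in> boundary_verts M"
    using bvert_bij_betw[OF M(1)] j unfolding v_def M(2) by (meson bij_betwE)
  \<comment> \<open>The change between rows \<open>c\<close> and \<open>c + 1\<close> yields an arc
    of color \<open>c\<close> at \<open>v\<close>.\<close>
  have "fst ` arcs_at C v \<noteq> {}"
    unfolding arcs_at_def image_Un v_def in_arc_colors[OF j] out_arc_colors[OF j]
    using change by blast
  then have ne: "arcs_at C v \<noteq> {}"
    by blast
  have e: "e \<in> edges G" "v \<in> {pathstart e, pathfinish e}"
    and sub: "\<And>a. a \<in> arcs_at C v \<Longrightarrow> path_image e \<subseteq> path_image (f a)"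
    using edge_at_boundary[OF v ne] by (auto simp: e_def)
  have arc: "arc e" "arc (reversepath e)"
    using edge_props(1)[OF e(1)] by (auto simp: arc_reversepath)
  have colors: "colors_with S e = {c. \<exists>a\<in>C. fst a = c \<and> traverses (f a) e}"
      "colors_against S e = {c. \<exists>a\<in>C. fst a = c \<and> traverses (f a) (reversepath e)}"
    using colors_with_iff colors_against_iff by blast+
  note into = colors_into_boundary[OF v, unfolded v_def in_arc_colors[OF j], folded v_def]
  note out_of = colors_from_boundary[OF v, unfolded v_def out_arc_colors[OF j], folded v_def]
  have vec: "boundary_vector n G S j c =
      (if pathfinish e = v then edge_vector n S e c else 1 - edge_vector n S e c)"
    by (simp add: boundary_vector_def Let_def incidence_sign_def bvert_G e_def v_def)
  show ?thesis
  proof (cases "pathfinish e = v")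
    case True
    have "edge_vector n S e c = (if c \<in> {c. j \<in> row T c} then 1 else 0)"
      using edges_G[OF e(1)] c into[OF arc(1) True sub] out_of[OF arc(2)] True sub
      by (intro edge_vector_eq_indicator) (auto simp: colors)
    then show ?thesis
      using True by (simp add: vec)
  next
    case False
    then have start: "pathstart e = v"
      using e(2) by simp
    \<comment> \<open>With the complementary set of rows, the colors of the out-arcs become those
      running with \<open>e\<close>.\<close>
    have "edge_vector n S e c = (if c \<in> {c. j \<notin> row T c} then 1 else 0)"
      using edges_G[OF e(1)] c out_of[OF arc(1) start sub] into[OF arc(2)] start sub
      by (intro edge_vector_eq_indicator) (auto simp: colors)
    then show ?thesis
      using False by (simp add: vec)
  qed
qed

end

theorem theorem45:
  fixes n m :: nat and k :: "nat \<Rightarrow> nat" and T :: "nat list list"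
    and M :: halfplane_graph and C :: "colored_curve set"
    and G :: weighted_graph and S :: "colored_curve set"
  assumes "n \<ge> 2"
    and "\<forall>i\<in>{1..m}. 1 \<le> k i \<and> k i < n"
    and "T \<in> RST n m k"
    and "colored_noncrossing_matching n m T M C"
    and "web_and_stranding_of M C G S"
  shows "stranding_tableau n G S = T"
proof -
  define B where "B = {v\<in>boundary_verts M. card (arcs_at C v) > 1}"
  define R where "R = interior_verts M \<union> B"
  obtain U W \<rho> f where web:
    "\<forall>z\<in>interior_verts M. crossing_replacement C z (U z) (W z) (\<rho> z)"
    "\<forall>v\<in>B. trunk_replacement C v (U v) (W v) (\<rho> v)"
    "disjoint_family_on U R"
    "\<forall>a\<in>C. arc (f a) \<and> pathstart (f a) = pathstart (snd a) \<and>
        pathfinish (f a) = pathfinish (snd a) \<and>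
        path_image (f a) = (path_image (snd a) - (\<Union>z\<in>R. U z)) \<union> (\<Union>z\<in>R. \<rho> z a)"
    "S = (\<lambda>a. (fst a, f a)) ` C" "halfplane_graph G"
    "verts G = boundary_verts M \<union> (\<Union>z\<in>R. W z)" "curve_system G (snd ` S)"
    "\<forall>e\<in>edges G. colors_on S e \<noteq> {} \<and> Max (colors_on S e) \<in> colors_with S e \<and>
        weight G e = (\<Sum>c\<in>colors_on S e. color_sign S e c * int c)"
    using assms(5) unfolding web_and_stranding_of_def Let_def B_def[symmetric] R_def[symmetric]
    by (elim exE conjE) (rule that)
  interpret matching_web n m T M C G S U W \<rho> f B R
    using assms(4) web B_def R_def by unfold_locales blast+
  \<comment> \<open>The bounds on \<open>k j\<close> enter here, through the existence of a
    change.\<close>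
  have "boundary_vector n G S j c = 1 \<longleftrightarrow> j \<in> row T c" if "j \<in> {1..m}" "c \<in> {1..n}" for j c
    using boundary_vector_eq_indicator[OF that(1) RST_exists_change[OF assms(3) that(1)] that(2)]
      assms(2) that(1) by simp
  then have rows: "{j\<in>{1..m}. boundary_vector n G S j c = 1} = row T c" if "c \<in> {1..n}" for c
    using RST_row_subset[OF assms(3) that] that by blast
  have "stranding_tableau n G S = map (\<lambda>c. sorted_list_of_set (row T c)) [1..<Suc n]"
    unfolding stranding_tableau_def boundary_verts_G M(2)
    by (intro map_cong arg_cong[of _ _ sorted_list_of_set] rows) auto
  also have "\<dots> = map (\<lambda>c. T ! (c - 1)) [1..<Suc n]"
    by (intro map_cong RST_row_nth[OF assms(3), symmetric]) auto
  \<comment> \<open>Rows are numbered from 1 and list positions from 0: entry \<open>i\<close> of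
    \<open>[1..<Suc n]\<close> is \<open>i + 1\<close>.\<close>
  also have "\<dots> = T"
    using assms(3) by (intro nth_equalityI) (auto simp: RST_def simp del: upt_Suc)
  finally show ?thesis .
qed

end
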